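(* Let $X:=\mathbb{R}^n$ with the Euclidean inner product and norm. Suppose that $T:X\to X$ is a separator of a nonempty subset $S\subseteq X$. Let $x\in X$, $q\in S$ and $\lambda\in[0,2]$. If $e\in X$ satisfies $$\|e\|\leq\frac{\lambda(2-\lambda)\|T(x)-x\|^2}{\sqrt{\zeta}+\lambda\|T(x)-x\|+\|x-q\|},\qquad(\ast)$$ where $$\zeta:=\bigl(\lambda\|T(x)-x\|+\|x-q\|\bigr)^2+\lambda(2-\lambda)\|T(x)-x\|^2,$$ and if $y:=x+\lambda(T(x)-x)+e$, then $$\|y-q\|\leq\|x-q\|.$$ If, in addition, $x\neq T(x)$, $0<\lambda<2$ and $e$ satisfies $(\ast)$ with strict inequality, then $$\|y-q\|<\|x-q\|.$$
   Context: An operator $T:X\to X$ is a separator of a nonempty set $S\subseteq X$ if $\langle x-T(x),q-T(x)\rangle\le 0$ for all $q\in S$ and $x\in X$. Convention: if the denominator in $(\ast)$ vanishes (in which case the numerator vanishes too), both sides of $(\ast)$ are understood to be zero, i.e. $(\ast)$ means $e=0$. *)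

theory Defs
  imports "HOL-Analysis.Analysis"
begin

definition separator :: "('a::real_inner \<Rightarrow> 'a) \<Rightarrow> 'a set \<Rightarrow> bool" where
  "separator T S \<longleftrightarrow> (\<forall>q\<in>S. \<forall>x. (x - T x) \<bullet> (q - T x) \<le> 0)"

definition pert_zeta :: "('a::real_inner \<Rightarrow> 'a) \<Rightarrow> real \<Rightarrow> 'a \<Rightarrow> 'a \<Rightarrow> real" where
  "pert_zeta T r x q =
     (r * norm (T x - x) + norm (x - q))\<^sup>2 + r * (2 - r) * (norm (T x - x))\<^sup>2"

text \<open>
  The parameter \<open>r\<close> is the relaxation parameter $\lambda$ of the iteration
  \<open>x + r *\<^sub>R (T x - x) + e\<close>. If the denominator vanishes, division
  by zero yields 0, so that \<open>norm e \<le> pert_bound T r x q\<close> then means \<open>e = 0\<close>,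
  which is the intended convention.
\<close>
definition pert_bound :: "('a::real_inner \<Rightarrow> 'a) \<Rightarrow> real \<Rightarrow> 'a \<Rightarrow> 'a \<Rightarrow> real" where
  "pert_bound T r x q =
     (r * (2 - r) * (norm (T x - x))\<^sup>2) /
     (sqrt (pert_zeta T r x q) + r * norm (T x - x) + norm (x - q))"

end

theory Submission
  imports Defs
begin

text \<open>
  Write \<open>d = norm (T x - x)\<close>, \<open>c = r * d + norm (x - q)\<close> and \<open>k = r * (2 - r) * d\<^sup>2\<close>.
  Rationalising the quotient shows that the bound equals \<open>sqrt (c\<^sup>2 + k) - c\<close>, so it is the
  larger root of \<open>t\<^sup>2 + 2 * c * t = k\<close>. The unperturbed step \<open>z\<close> satisfies
  \<open>(norm (z - q))\<^sup>2 \<le> (norm (x - q))\<^sup>2 - k\<close> and \<open>norm (z - q) \<le> c\<close>, and hence adding \<open>e\<close> costs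
  at most \<open>(norm e)\<^sup>2 + 2 * c * norm e\<close> in the squared distance.
\<close>

lemma pert_bound_eq:
  assumes "r \<in> {0..2}"
  shows "pert_bound T r x q =
    sqrt (pert_zeta T r x q) - (r * norm (T x - x) + norm (x - q))"
proof -
  define c where "c = r * norm (T x - x) + norm (x - q)"
  define k where "k = r * (2 - r) * (norm (T x - x))\<^sup>2"
  define s where "s = sqrt (c\<^sup>2 + k)"
  have "c \<ge> 0" "k \<ge> 0"
    using assms by (auto simp: c_def k_def)
  then have "s \<ge> 0" and "s\<^sup>2 = c\<^sup>2 + k"
    by (auto simp: s_def)
  then have "k = (s - c) * (s + c)"
    by (simp add: power2_eq_square algebra_simps)
  with \<open>c \<ge> 0\<close> \<open>s \<ge> 0\<close> have "k / (s + c) = s - c"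
    \<comment> \<open>If \<open>s + c = 0\<close>, nonnegativity forces \<open>s = c = 0\<close>, so
      both sides are 0 under division by zero.\<close>
    by (cases "s + c = 0") auto
  then show ?thesis
    by (simp add: pert_bound_def pert_zeta_def s_def c_def k_def add.assoc)
qed

text \<open>Expand the square and split \<open>x - q\<close> at \<open>T x\<close>: besides the
  claimed right-hand side, only a multiple of the separator's inner product remains, and it is
  nonpositive.\<close>

lemma separator_relaxation:
  assumes "separator T S" "q \<in> S" "r \<ge> 0"
  shows "(norm (x + r *\<^sub>R (T x - x) - q))\<^sup>2
    \<le> (norm (x - q))\<^sup>2 - r * (2 - r) * (norm (T x - x))\<^sup>2"
proof -
  have "(x - T x) \<bullet> (q - T x) \<le> 0"
    using assms by (simp add: separator_def)
  then have "2 * r * ((x - T x) \<bullet> (q - T x)) \<le> 0"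
    using \<open>r \<ge> 0\<close> by (simp add: mult_nonneg_nonpos)
  moreover have "(norm (x + r *\<^sub>R (T x - x) - q))\<^sup>2 =
      (norm (x - q))\<^sup>2 - r * (2 - r) * (norm (T x - x))\<^sup>2 + 2 * r * ((x - T x) \<bullet> (q - T x))"
    unfolding power2_norm_eq_inner
    by (simp add: inner_simps inner_commute algebra_simps)
  ultimately show ?thesis
    by simp
qed

text \<open>Completing the square in \<open>norm e\<close> gives the excess this form, so its sign
  can be read off by comparing \<open>norm e + c\<close> with the square root of
  \<open>pert_zeta\<close>.\<close>

lemma separator_perturbed_relaxation:
  fixes x q e :: "'a::real_inner"
  assumes "separator T S" "q \<in> S" "r \<ge> 0"
  shows "(norm (x + r *\<^sub>R (T x - x) + e - q))\<^sup>2 \<le> (norm (x - q))\<^sup>2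
    + ((norm e + (r * norm (T x - x) + norm (x - q)))\<^sup>2 - pert_zeta T r x q)"
proof -
  define z where "z = x + r *\<^sub>R (T x - x)"
  define c where "c = r * norm (T x - x) + norm (x - q)"
  have "norm (z - q) = norm (r *\<^sub>R (T x - x) + (x - q))"
    by (simp add: z_def algebra_simps)
  then have "norm (z - q) \<le> c"
    using norm_triangle_ineq[of "r *\<^sub>R (T x - x)" "x - q"] \<open>r \<ge> 0\<close>
    by (simp add: c_def)
  \<comment> \<open>This controls the cross term of
    \<open>(norm (z - q) + norm e)\<^sup>2\<close>.\<close>
  then have "norm (z - q) * norm e \<le> c * norm e"
    by (simp add: mult_right_mono)
  moreover have "(norm (z + e - q))\<^sup>2 \<le> (norm (z - q) + norm e)\<^sup>2"
    using norm_triangle_ineq[of "z - q" e] by (intro power_mono) (simp_all add: algebra_simps)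
  moreover have "(norm (z - q))\<^sup>2
      \<le> (norm (x - q))\<^sup>2 - r * (2 - r) * (norm (T x - x))\<^sup>2"
    unfolding z_def by (rule separator_relaxation[OF assms])
  ultimately have "(norm (z + e - q))\<^sup>2
      \<le> (norm (x - q))\<^sup>2 + ((norm e + c)\<^sup>2 - (c\<^sup>2 + r * (2 - r) * (norm (T x - x))\<^sup>2))"
    unfolding power2_sum by (simp add: mult.commute)
  then show ?thesis
    by (simp add: z_def c_def pert_zeta_def)
qed

theorem lemma5p2:
  fixes T :: "real ^ 'n \<Rightarrow> real ^ 'n"
    and S :: "(real ^ 'n) set"
    and x q e y :: "real ^ 'n"
    and r :: real
  assumes "S \<noteq> {}"
    and "separator T S"
    and "q \<in> S"
    and "r \<in> {0..2}"
    and "norm e \<le> pert_bound T r x q"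
    and "y = x + r *\<^sub>R (T x - x) + e"
  shows "norm (y - q) \<le> norm (x - q) \<and>
    (x \<noteq> T x \<and> 0 < r \<and> r < 2 \<and> norm e < pert_bound T r x q
       \<longrightarrow> norm (y - q) < norm (x - q))"
proof -
  define c where "c = r * norm (T x - x) + norm (x - q)"
  define \<zeta> where "\<zeta> = pert_zeta T r x q"
  have "r \<ge> 0"
    using assms by simp
  then have nonneg: "norm e + c \<ge> 0"
    by (simp add: c_def)
  have "\<zeta> \<ge> 0"
    using assms by (simp add: \<zeta>_def pert_zeta_def)
  then have sqrt_sq: "(sqrt \<zeta>)\<^sup>2 = \<zeta>"
    by simp
  have bound: "pert_bound T r x q = sqrt \<zeta> - c"
    using pert_bound_eq assms by (simp add: \<zeta>_def c_def)
  have dist: "(norm (y - q))\<^sup>2 \<le> (norm (x - q))\<^sup>2 + ((norm e + c)\<^sup>2 - \<zeta>)"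
    using separator_perturbed_relaxation[OF assms(2,3) \<open>r \<ge> 0\<close>] assms(6)
    by (simp add: \<zeta>_def c_def)
  have "norm (y - q) \<le> norm (x - q)"
  proof (rule power2_le_imp_le)
    \<comment> \<open>By \<open>bound\<close>, the hypothesis on \<open>e\<close> says
      \<open>norm e + c \<le> sqrt \<zeta>\<close>; squaring makes the excess in \<open>dist\<close>
      nonpositive.\<close>
    have "(norm e + c)\<^sup>2 \<le> (sqrt \<zeta>)\<^sup>2"
      using assms(5) nonneg bound by (intro power_mono) auto
    with dist sqrt_sq show "(norm (y - q))\<^sup>2 \<le> (norm (x - q))\<^sup>2"
      by linarith
  qed simp
  moreover have "norm (y - q) < norm (x - q)" if "norm e < pert_bound T r x q"
  proof (rule power_less_imp_less_base)
    \<comment> \<open>Squaring preserves strictness since \<open>norm e + c\<close> is nonnegative,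
      so the excess is now negative.\<close>
    have "(norm e + c)\<^sup>2 < (sqrt \<zeta>)\<^sup>2"
      using that nonneg bound by (intro power_strict_mono) auto
    with dist sqrt_sq show "(norm (y - q))\<^sup>2 < (norm (x - q))\<^sup>2"
      by linarith
  qed simp
  ultimately show ?thesis
    by blast
qed

end
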